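(* Consider a linear quantum system with $n$ oscillators and $m$ input channels and parameters $(S,C_-,C_+,\Omega_-,\Omega_+)$ (all notation as in the context). Suppose that $S$ is real, $\Omega$ is purely imaginary, and $\mathcal{C}$ is real or purely imaginary. Then quantum back-action-evading (BAE) measurements of $\mathbf{q}_{\rm out}$ with respect to $\mathbf{p}_{\rm in}$ and of $\mathbf{p}_{\rm out}$ with respect to $\mathbf{q}_{\rm in}$ are realized, i.e. $\mathbb{G}_{\mathbf{p}_{\rm in}\to\mathbf{q}_{\rm out}}[s]\equiv 0$ and $\mathbb{G}_{\mathbf{q}_{\rm in}\to\mathbf{p}_{\rm out}}[s]\equiv 0$. If further (i) $C_-=C_+$ (so that $\mathbf{q}$ is coupled with the environment), then $\mathbf{q}$ is a QND variable if the subsystem $(\imath(\Omega_-+\Omega_+),0,C_-)$ is observable; (ii) $C_-=-C_+$ (so that $\mathbf{p}$ is coupled with the environment), then $\mathbf{p}$ is a QND variable if the subsystem $(\imath(\Omega_--\Omega_+),0,C_-)$ is observable.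
   Context: $\imath=\sqrt{-1}$; $X^\#$ is the entrywise complex conjugate (adjoint, for operator entries), $X^\dagger=(X^\#)^\top$; $\Delta(U,V)=\begin{bmatrix} U & V \\ V^\# & U^\# \end{bmatrix}$; $J_k=\mathrm{diag}(I_k,-I_k)$; for $X\in\mathbf{C}^{2k\times 2r}$, $X^\flat=J_rX^\dagger J_k$; $V_k=\frac1{\sqrt2}\begin{bmatrix} I_k & I_k \\ -\imath I_k & \imath I_k \end{bmatrix}$. A matrix is purely imaginary if its real part is zero. A linear quantum system is specified by: a unitary $S\in\mathbf{C}^{m\times m}$; matrices $C_-,C_+\in\mathbf{C}^{m\times n}$, with $\mathcal{C}=\Delta(C_-,C_+)$; and $\Omega_-,\Omega_+\in\mathbf{C}^{n\times n}$ such that $\Omega=\Delta(\Omega_-,\Omega_+)$ is Hermitian (equivalently $\Omega_-$ Hermitian, $\Omega_+$ symmetric). The coupling operator is $\mathbf{L}=C_-\mathbf{a}+C_+\mathbf{a}^\#$ and the Hamiltonian is $\mathbf{H}=\frac12\begin{bmatrix} \mathbf{a} \\ \mathbf{a}^\# \end{bmatrix}^\dagger\Omega\begin{bmatrix} \mathbf{a} \\ \mathbf{a}^\# \end{bmatrix}$, where $\mathbf{a}=(\mathbf{a}_1,\dots,\mathbf{a}_n)^\top$ are annihilation operators. In real quadrature form the system is $$\dot{\mathbf{x}}=\mathbb{A}\mathbf{x}+\mathbb{B}\mathbf{u},\qquad \mathbf{y}=\mathbb{C}\mathbf{x}+\mathbb{D}\mathbf{u},\qquad \mathbf{x}=\begin{bmatrix}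 \mathbf{q} \\ \mathbf{p} \end{bmatrix},\ \mathbf{u}=\begin{bmatrix} \mathbf{q}_{\rm in} \\ \mathbf{p}_{\rm in} \end{bmatrix},\ \mathbf{y}=\begin{bmatrix} \mathbf{q}_{\rm out} \\ \mathbf{p}_{\rm out} \end{bmatrix},$$ where $\mathbb{D}=V_m\Delta(S,0)V_m^\dagger$, $\mathbb{C}=V_m\mathcal{C}V_n^\dagger$, $\mathbb{B}=-V_n\mathcal{C}^\flat\Delta(S,0)V_m^\dagger$, $\mathbb{A}=V_n\left(-\imath J_n\Omega-\frac12\mathcal{C}^\flat\mathcal{C}\right)V_n^\dagger$ are real matrices. The transfer matrix is $\mathbb{G}[s]=\mathbb{D}+\mathbb{C}(sI-\mathbb{A})^{-1}\mathbb{B}$, partitioned into four $m\times m$ blocks conformably with $\mathbf{u}$ and $\mathbf{y}$; e.g. $\mathbb{G}_{\mathbf{p}_{\rm in}\to\mathbf{q}_{\rm out}}$ is the $(1,2)$ block. A BAE measurement of an output quadrature with respect to an input quadrature is realized when the corresponding transfer block vanishes identically. A vector of system variables $\mathbf{z}=T\mathbf{x}$ ($T$ a real matrix) is a QND variable if it evolves autonomously and independently of the inputs ($T\mathbb{A}=FT$ for some matrix $F$, and $T\mathbb{B}=0$; in particular it is uncontrollable) and is observable from the output (the rows of $T$ lie in the row space of the observability matrix of $(\mathbb{A},\mathbb{C})$). A subsystem $(A,0,C)$ is observable if the pair $(A,C)$ is observable in the usual sense. *)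

theory Defs
  imports "HOL-Analysis.Analysis"
begin

text \<open>
  A complex \<open>k \<times> l\<close> matrix is an element of \<^typ>\<open>complex^'l^'k\<close>. Vectors and matrices of
  doubled size are indexed by \<^typ>\<open>'k + 'k\<close>: \<^const>\<open>Inl\<close> selects the upper half (the
  \<open>q\<close> components, or \<open>a\<close>) and \<^const>\<open>Inr\<close> the lower half (the \<open>p\<close> components, or the
  adjoints of \<open>a\<close>).
\<close>

section \<open>Matrix notation\<close>

definition block_mat ::
  "'a^'l1^'k1 \<Rightarrow> 'a^'l2^'k1 \<Rightarrow> 'a^'l1^'k2 \<Rightarrow> 'a^'l2^'k2 \<Rightarrow> 'a^('l1 + 'l2)^('k1 + 'k2)" where
  "block_mat P Q R T = (\<chi> i j.
     case i of
       Inl a \<Rightarrow> (case j of Inl b \<Rightarrow> P $ a $ b | Inr b \<Rightarrow> Q $ a $ b)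
     | Inr a \<Rightarrow> (case j of Inl b \<Rightarrow> R $ a $ b | Inr b \<Rightarrow> T $ a $ b))"

definition upper_right_block :: "'a^('l1::finite + 'l2)^('k1 + 'k2::finite) \<Rightarrow> 'a^'l2^'k1" where
  "upper_right_block M = (\<chi> i j. M $ Inl i $ Inr j)"

definition lower_left_block :: "'a^('l1 + 'l2::finite)^('k1::finite + 'k2) \<Rightarrow> 'a^'l1^'k2" where
  "lower_left_block M = (\<chi> i j. M $ Inr i $ Inl j)"

definition cscale :: "complex \<Rightarrow> complex^'l^'k \<Rightarrow> complex^'l^'k" where
  "cscale c X = map_matrix ((*) c) X"

definition conj_mat :: "complex^'l^'k \<Rightarrow> complex^'l^'k" where
  "conj_mat X = map_matrix cnj X"

definition dagger :: "complex^'l^'k \<Rightarrow> complex^'k^'l" where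
  "dagger X = transpose (conj_mat X)"

definition hermitian :: "complex^'k^'k \<Rightarrow> bool" where
  "hermitian X \<longleftrightarrow> dagger X = X"

definition unitary :: "complex^'k^'k \<Rightarrow> bool" where
  "unitary X \<longleftrightarrow> dagger X ** X = mat 1 \<and> X ** dagger X = mat 1"

definition real_mat :: "complex^'l^'k \<Rightarrow> bool" where
  "real_mat X \<longleftrightarrow> (\<forall>i j. Im (X $ i $ j) = 0)"

definition purely_imaginary_mat :: "complex^'l^'k \<Rightarrow> bool" where
  "purely_imaginary_mat X \<longleftrightarrow> (\<forall>i j. Re (X $ i $ j) = 0)"

text \<open>The power type class on \<^typ>\<open>'a^'k^'k\<close> is entrywise, hence a separate definition.\<close>

primrec mat_pow :: "'a::semiring_1^'k^'k \<Rightarrow> nat \<Rightarrow> 'a^'k^'k" where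
  "mat_pow A 0 = mat 1"
| "mat_pow A (Suc j) = mat_pow A j ** A"

definition Delta :: "complex^'l^'k \<Rightarrow> complex^'l^'k \<Rightarrow> complex^('l + 'l)^('k + 'k)" where
  "Delta U V = block_mat U V (conj_mat V) (conj_mat U)"

definition Jmat :: "complex^('k::finite + 'k)^('k + 'k)" where
  "Jmat = block_mat (mat 1) 0 0 (- mat 1)"

definition flat :: "complex^('r::finite + 'r)^('k::finite + 'k) \<Rightarrow> complex^('k + 'k)^('r + 'r)" where
  "flat X = Jmat ** dagger X ** Jmat"

definition Vmat :: "complex^('k::finite + 'k)^('k + 'k)" where
  "Vmat = cscale (complex_of_real (1 / sqrt 2))
            (block_mat (mat 1) (mat 1) (mat (- \<i>)) (mat \<i>))"


section \<open>The system matrices\<close>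

text \<open>
  The system matrices are given by complex formulas whose values turn out to be real matrices.
  The real matrices \<open>sys_A\<close> to \<open>sys_D\<close> are the entrywise real parts of these values, and the
  lemmas \<open>of_real_sys_A\<close> to \<open>of_real_sys_D\<close> show that no information is lost.
\<close>

definition cplx_D :: "complex^'m^'m \<Rightarrow> complex^('m + 'm)^('m + 'm)" where
  "cplx_D S = Vmat ** Delta S 0 ** dagger Vmat"

definition cplx_C :: "complex^'n^'m \<Rightarrow> complex^'n^'m \<Rightarrow> complex^('n + 'n)^('m + 'm)" where
  "cplx_C Cm Cp = Vmat ** Delta Cm Cp ** dagger Vmat"

definition cplx_B ::
  "complex^'m^'m \<Rightarrow> complex^'n^'m \<Rightarrow> complex^'n^'m \<Rightarrow> complex^('m + 'm)^('n + 'n)" where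
  "cplx_B S Cm Cp = - (Vmat ** flat (Delta Cm Cp) ** Delta S 0 ** dagger Vmat)"

definition cplx_A ::
  "complex^'n^'m \<Rightarrow> complex^'n^'m \<Rightarrow> complex^'n^'n \<Rightarrow> complex^'n^'n \<Rightarrow>
     complex^('n + 'n)^('n + 'n)" where
  "cplx_A Cm Cp Om Op =
     Vmat ** (cscale (- \<i>) (Jmat ** Delta Om Op)
              - cscale (1 / 2) (flat (Delta Cm Cp) ** Delta Cm Cp)) ** dagger Vmat"

definition sys_D :: "complex^'m^'m \<Rightarrow> real^('m + 'm)^('m + 'm)" where
  "sys_D S = map_matrix Re (cplx_D S)"

definition sys_C :: "complex^'n^'m \<Rightarrow> complex^'n^'m \<Rightarrow> real^('n + 'n)^('m + 'm)" where
  "sys_C Cm Cp = map_matrix Re (cplx_C Cm Cp)"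

definition sys_B ::
  "complex^'m^'m \<Rightarrow> complex^'n^'m \<Rightarrow> complex^'n^'m \<Rightarrow> real^('m + 'm)^('n + 'n)" where
  "sys_B S Cm Cp = map_matrix Re (cplx_B S Cm Cp)"

definition sys_A ::
  "complex^'n^'m \<Rightarrow> complex^'n^'m \<Rightarrow> complex^'n^'n \<Rightarrow> complex^'n^'n \<Rightarrow>
     real^('n + 'n)^('n + 'n)" where
  "sys_A Cm Cp Om Op = map_matrix Re (cplx_A Cm Cp Om Op)"


subsection \<open>The system matrices are real\<close>

definition swap :: "complex^('k::finite + 'k)^('k + 'k)" where
  "swap = block_mat 0 (mat 1) (mat 1) 0"

definition doubled_up :: "complex^('l::finite + 'l)^('k::finite + 'k) \<Rightarrow> bool" where
  "doubled_up X \<longleftrightarrow> conj_mat X = swap ** X ** swap"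

lemma block_mat_mult:
  fixes P :: "'a::semiring_1^'l1^'k1"
  shows "block_mat P Q R T ** block_mat P' Q' R' T' =
    block_mat (P ** P' + Q ** R') (P ** Q' + Q ** T') (R ** P' + T ** R') (R ** Q' + T ** T')"
proof -
  have plus: "(\<Sum>x\<in>UNIV. g x) = (\<Sum>x\<in>UNIV. g (Inl x)) + (\<Sum>x\<in>UNIV. g (Inr x))"
    for g :: "'x::finite + 'y::finite \<Rightarrow> 'a"
    by (subst UNIV_Plus_UNIV[symmetric], subst sum.Plus) simp_all
  show ?thesis
    by (simp add: vec_eq_iff block_mat_def matrix_matrix_mult_def plus split: sum.split)
qed

lemma mat_1_block: "mat 1 = block_mat (mat 1) 0 0 (mat 1)"
  by (simp add: vec_eq_iff block_mat_def mat_def split: sum.split)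

lemma swap_swap: "swap ** swap = mat 1"
  by (simp add: swap_def block_mat_mult mat_1_block)

lemma swap_swap_left: "swap ** (swap ** X) = X"
  by (simp add: matrix_mul_assoc swap_swap)

lemma conj_mat_mult: "conj_mat (X ** Y) = conj_mat X ** conj_mat Y"
  by (simp add: vec_eq_iff conj_mat_def matrix_matrix_mult_def)

lemma conj_mat_block:
  "conj_mat (block_mat P Q R T) = block_mat (conj_mat P) (conj_mat Q) (conj_mat R) (conj_mat T)"
  by (simp add: vec_eq_iff block_mat_def conj_mat_def split: sum.split)

lemma conj_conj_mat: "conj_mat (conj_mat X) = X"
  by (simp add: vec_eq_iff conj_mat_def)

lemma conj_mat_dagger: "conj_mat (dagger X) = dagger (conj_mat X)"
  by (simp add: vec_eq_iff conj_mat_def dagger_def transpose_def)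

lemma dagger_mult: "dagger (X ** Y) = dagger Y ** dagger X"
  by (simp add: dagger_def conj_mat_mult matrix_transpose_mul)

lemma dagger_swap: "dagger swap = swap"
  by (auto simp: vec_eq_iff dagger_def conj_mat_def transpose_def swap_def block_mat_def mat_def
      split: sum.split)

lemma doubled_up_Delta: "doubled_up (Delta U V)"
  by (simp add: doubled_up_def Delta_def swap_def conj_mat_block block_mat_mult conj_conj_mat)

lemma doubled_up_mult: "doubled_up X \<Longrightarrow> doubled_up Y \<Longrightarrow> doubled_up (X ** Y)"
  by (simp add: doubled_up_def conj_mat_mult matrix_mul_assoc[symmetric] swap_swap_left)

lemma doubled_up_dagger: "doubled_up X \<Longrightarrow> doubled_up (dagger X)"
  by (simp add: doubled_up_def conj_mat_dagger dagger_mult dagger_swap matrix_mul_assoc)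

lemma doubled_up_diff: "doubled_up X \<Longrightarrow> doubled_up Y \<Longrightarrow> doubled_up (X - Y)"
proof -
  have "conj_mat (X - Y) = conj_mat X - conj_mat Y"
    by (simp add: vec_eq_iff conj_mat_def)
  moreover have "swap ** (X - Y) ** swap = swap ** X ** swap - swap ** Y ** swap"
    by (simp add: vec_eq_iff matrix_matrix_mult_def algebra_simps sum_subtractf)
  ultimately show "doubled_up X \<Longrightarrow> doubled_up Y \<Longrightarrow> doubled_up (X - Y)"
    by (simp add: doubled_up_def)
qed

lemma cscale_mult_left: "cscale c X ** Y = cscale c (X ** Y)"
  by (simp add: vec_eq_iff cscale_def matrix_matrix_mult_def sum_distrib_left mult.assoc)

lemma cscale_mult_right: "X ** cscale c Y = cscale c (X ** Y)"
  by (simp add: vec_eq_iff cscale_def matrix_matrix_mult_def sum_distrib_left algebra_simps)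

lemma conj_mat_cscale: "conj_mat (cscale c X) = cscale (cnj c) (conj_mat X)"
  by (simp add: vec_eq_iff cscale_def conj_mat_def)

lemma doubled_up_cscale_half: "doubled_up X \<Longrightarrow> doubled_up (cscale (1 / 2) X)"
  by (simp add: doubled_up_def conj_mat_cscale cscale_mult_left cscale_mult_right)

lemma doubled_up_iJ: "doubled_up (cscale (- \<i>) (Jmat :: complex^('k::finite + 'k)^('k + 'k)))"
proof -
  have "cscale (- \<i>) Jmat = Delta (mat (- \<i>) :: complex^'k^'k) 0"
    by (auto simp: vec_eq_iff cscale_def conj_mat_def Jmat_def Delta_def block_mat_def mat_def
        split: sum.split)
  then show ?thesis by (simp add: doubled_up_Delta)
qed

lemma flat_alt: "flat X = cscale (- 1) (cscale (- \<i>) Jmat ** dagger X ** cscale (- \<i>) Jmat)"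
  by (simp add: flat_def cscale_mult_left cscale_mult_right) (simp add: vec_eq_iff cscale_def)

lemma doubled_up_flat: "doubled_up X \<Longrightarrow> doubled_up (flat X)"
proof -
  assume "doubled_up X"
  then have "doubled_up (cscale (- \<i>) Jmat ** dagger X ** cscale (- \<i>) Jmat)"
    by (intro doubled_up_mult doubled_up_iJ doubled_up_dagger)
  then show ?thesis
    unfolding flat_alt by (simp add: doubled_up_def conj_mat_cscale cscale_mult_left cscale_mult_right)
qed

lemma conj_mat_mat: "conj_mat (mat c) = mat (cnj c)"
  by (auto simp: vec_eq_iff conj_mat_def mat_def)

lemma conj_Vmat: "conj_mat Vmat = Vmat ** swap"
  by (simp add: Vmat_def swap_def conj_mat_cscale cscale_mult_left conj_mat_block block_mat_mult
      conj_mat_mat)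

lemma of_real_Re_quadrature:
  assumes "doubled_up X"
  shows "map_matrix of_real (map_matrix Re (Vmat ** X ** dagger Vmat)) = Vmat ** X ** dagger Vmat"
proof -
  have "conj_mat (Vmat ** X ** dagger Vmat) = Vmat ** X ** dagger Vmat"
    using assms
    by (simp add: conj_mat_mult conj_mat_dagger conj_Vmat dagger_mult dagger_swap doubled_up_def
        matrix_mul_assoc[symmetric] swap_swap_left)
  then have "cnj ((Vmat ** X ** dagger Vmat) $ i $ j) = (Vmat ** X ** dagger Vmat) $ i $ j" for i j
    by (metis conj_mat_def nth_map_matrix)
  then have "of_real (Re ((Vmat ** X ** dagger Vmat) $ i $ j)) = (Vmat ** X ** dagger Vmat) $ i $ j"
    for i j
    by (metis Reals_cnj_iff of_real_Re)
  then show ?thesis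
    by (simp add: vec_eq_iff)
qed

lemma of_real_sys_D: "map_matrix of_real (sys_D S) = cplx_D S"
  unfolding sys_D_def cplx_D_def by (intro of_real_Re_quadrature doubled_up_Delta)

lemma of_real_sys_C: "map_matrix of_real (sys_C Cm Cp) = cplx_C Cm Cp"
  unfolding sys_C_def cplx_C_def by (intro of_real_Re_quadrature doubled_up_Delta)

lemma of_real_sys_B: "map_matrix of_real (sys_B S Cm Cp) = cplx_B S Cm Cp"
proof -
  have "map_matrix of_real (map_matrix Re (Vmat ** (flat (Delta Cm Cp) ** Delta S 0) ** dagger Vmat))
      = Vmat ** (flat (Delta Cm Cp) ** Delta S 0) ** dagger Vmat"
    by (intro of_real_Re_quadrature doubled_up_mult doubled_up_flat doubled_up_Delta)
  then show ?thesis
    unfolding sys_B_def cplx_B_def by (simp add: vec_eq_iff matrix_mul_assoc)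
qed

lemma of_real_sys_A: "map_matrix of_real (sys_A Cm Cp Om Op) = cplx_A Cm Cp Om Op"
proof -
  have "doubled_up (cscale (- \<i>) (Jmat ** Delta Om Op))"
    unfolding cscale_mult_left[symmetric]
    by (intro doubled_up_mult doubled_up_iJ doubled_up_Delta)
  moreover have "doubled_up (cscale (1 / 2) (flat (Delta Cm Cp) ** Delta Cm Cp))"
    by (intro doubled_up_cscale_half doubled_up_mult doubled_up_flat doubled_up_Delta)
  ultimately show ?thesis
    unfolding sys_A_def cplx_A_def by (intro of_real_Re_quadrature doubled_up_diff)
qed


section \<open>Transfer matrix, observability and QND variables\<close>

text \<open>
  The transfer matrix is a rational function of \<open>s\<close>, and its value is meaningful only where
  \<open>s I - A\<close> is invertible, i.e. off the finite spectrum of \<open>A\<close>.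
\<close>

definition transfer_matrix ::
  "real^'x^'x \<Rightarrow> real^'u^'x \<Rightarrow> real^'x^'y \<Rightarrow> real^'u^'y \<Rightarrow> complex \<Rightarrow> complex^'u^'y" where
  "transfer_matrix A B C D s =
     map_matrix of_real D
     + map_matrix of_real C ** matrix_inv (mat s - map_matrix of_real A) ** map_matrix of_real B"

definition BAE_q_out_wrt_p_in ::
  "real^'x^'x \<Rightarrow> real^('m::finite + 'm)^'x \<Rightarrow> real^'x^('m + 'm) \<Rightarrow> real^('m + 'm)^('m + 'm) \<Rightarrow> bool" where
  "BAE_q_out_wrt_p_in A B C D \<longleftrightarrow>
     (\<forall>s. invertible (mat s - map_matrix complex_of_real A) \<longrightarrow>
          upper_right_block (transfer_matrix A B C D s) = 0)"

definition BAE_p_out_wrt_q_in ::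
  "real^'x^'x \<Rightarrow> real^('m::finite + 'm)^'x \<Rightarrow> real^'x^('m + 'm) \<Rightarrow> real^('m + 'm)^('m + 'm) \<Rightarrow> bool" where
  "BAE_p_out_wrt_q_in A B C D \<longleftrightarrow>
     (\<forall>s. invertible (mat s - map_matrix complex_of_real A) \<longrightarrow>
          lower_left_block (transfer_matrix A B C D s) = 0)"

text \<open>
  The rows of the observability matrix, i.e. of \<open>C, C A, \<dots>, C A\<^sup>k\<^sup>-\<^sup>1\<close> stacked on top of each
  other, where \<open>k\<close> is the number of state variables.
\<close>

definition observability_rows :: "'a::field^'x^'x \<Rightarrow> 'a^'x^'y \<Rightarrow> ('a^'x) set" where
  "observability_rows A C = (\<Union>j<CARD('x). rows (C ** mat_pow A j))"

text \<open>
  Full column rank of the observability matrix; compare the row rank in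
  \<open>row_rank_def_gen\<close>.
\<close>

definition observable :: "'a::field^'x^'x \<Rightarrow> 'a^'x^'y \<Rightarrow> bool" where
  "observable A C \<longleftrightarrow> vec.dim (observability_rows A C) = CARD('x)"

definition QND_variable ::
  "real^'x^'x \<Rightarrow> real^'u^'x \<Rightarrow> real^'x^'y \<Rightarrow> real^'x^'z \<Rightarrow> bool" where
  "QND_variable A B C T \<longleftrightarrow>
     (\<exists>F. T ** A = F ** T) \<and> T ** B = 0 \<and> rows T \<subseteq> span (observability_rows A C)"

definition q_selector :: "real^('n + 'n)^'n" where
  "q_selector = (\<chi> i j. case j of Inl k \<Rightarrow> mat 1 $ i $ k | Inr k \<Rightarrow> 0)"

definition p_selector :: "real^('n + 'n)^'n" where
  "p_selector = (\<chi> i j. case j of Inl k \<Rightarrow> 0 | Inr k \<Rightarrow> mat 1 $ i $ k)"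

end

theory Submission
  imports Defs
begin

text \<open>
  In quadratures a doubled-up matrix \<open>Delta U V\<close> becomes the real block matrix with rows
  \<open>(Re (U + V), Im (V - U))\<close> and \<open>(Im (U + V), Re (U - V))\<close>: it is block diagonal if
  \<open>U\<close>, \<open>V\<close> are real and block antidiagonal if they are purely imaginary. Under the
  hypotheses \<open>A\<close> and \<open>D\<close> are therefore block diagonal, while \<open>B\<close> and \<open>C\<close> are both block
  diagonal or both block antidiagonal, so the transfer matrix is block diagonal. If \<open>Cm = Cp\<close>,
  then \<open>q\<close> satisfies \<open>dq/dt = F q\<close> with \<open>F = Im (Om + Op) = - \<i> (Om + Op)\<close> and the output
  is a function of \<open>q\<close> whose coefficients are twice the real and imaginary parts of \<open>Cm\<close>.
  Taking real parts in complex linear combinations of the rows of \<open>Cm (\<i> (Om + Op))\<^sup>j\<close> turns the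
  observability of \<open>(\<i> (Om + Op), Cm)\<close> into that of this real system. The case \<open>Cm = - Cp\<close>
  is symmetric.
\<close>

section \<open>Quadrature form of doubled-up matrices\<close>

abbreviation Re_mat :: "complex^'l^'k \<Rightarrow> real^'l^'k" where
  "Re_mat \<equiv> map_matrix Re"

abbreviation Im_mat :: "complex^'l^'k \<Rightarrow> real^'l^'k" where
  "Im_mat \<equiv> map_matrix Im"

abbreviation cplx_mat :: "real^'l^'k \<Rightarrow> complex^'l^'k" where
  "cplx_mat \<equiv> map_matrix complex_of_real"

text \<open>For doubled-up \<open>X\<close> the product is already real by
  \<open>of_real_Re_quadrature\<close>, so \<open>Re_mat\<close> only changes the type.\<close>

definition quadrature ::
  "complex^('l::finite + 'l)^('k::finite + 'k) \<Rightarrow> real^('l + 'l)^('k + 'k)" where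
  "quadrature X = Re_mat (Vmat ** X ** dagger Vmat)"

lemma mat_mult_left: "mat c ** X = cscale c X"
  by (simp add: vec_eq_iff matrix_matrix_mult_def mat_def cscale_def if_distrib [where f = "\<lambda>x. x * _"]
      cong: if_cong)

lemma mat_mult_right: "X ** mat c = cscale c X"
  by (simp add: vec_eq_iff matrix_matrix_mult_def mat_def cscale_def if_distrib mult.commute
      cong: if_cong)

lemma uminus_mat_1: "- mat 1 = (mat (- 1) :: 'a::ring_1^'k^'k)"
  by (simp add: vec_eq_iff mat_def)

lemma dagger_Vmat:
  "dagger Vmat = cscale (complex_of_real (1 / sqrt 2))
     (block_mat (mat 1) (mat \<i>) (mat 1) (mat (- \<i>)))"
  by (auto simp: vec_eq_iff dagger_def conj_mat_def transpose_def Vmat_def cscale_def block_mat_def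
      mat_def split: sum.split)

lemma cscale_cscale: "cscale a (cscale b X) = cscale (a * b) X"
  by (simp add: vec_eq_iff cscale_def)

lemma sqrt_half_square:
  "complex_of_real (1 / sqrt 2) * complex_of_real (1 / sqrt 2) = 1 / 2"
  by (simp flip: of_real_mult)

lemma dagger_Vmat_Vmat: "dagger Vmat ** Vmat = mat 1"
proof -
  have *: "block_mat (mat 1) (mat \<i>) (mat 1) (mat (- \<i>)) **
      block_mat (mat 1) (mat 1) (mat (- \<i>)) (mat \<i>) = (mat 2 :: complex^('a + 'a)^('a + 'a))"
    unfolding block_mat_mult mat_mult_left
    by (auto simp: vec_eq_iff cscale_def block_mat_def mat_def split: sum.split)
  have "dagger Vmat ** Vmat = cscale (1 / 2) (mat 2 :: complex^('a + 'a)^('a + 'a))"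
    unfolding dagger_Vmat unfolding Vmat_def cscale_mult_left cscale_mult_right cscale_cscale *
      sqrt_half_square ..
  also have "\<dots> = mat 1"
    by (simp add: vec_eq_iff cscale_def mat_def)
  finally show ?thesis .
qed

text \<open>The two factors \<open>1 / sqrt 2\<close> combine to \<open>1 / 2\<close>. Each block is
  then half of a matrix plus its entrywise conjugate, up to factors of \<open>\<i>\<close>, which
  leaves a real or an imaginary part.\<close>

lemma quadrature_Delta:
  "quadrature (Delta U V) =
     block_mat (Re_mat (U + V)) (Im_mat (V - U)) (Im_mat (U + V)) (Re_mat (U - V))"
proof -
  have *: "Vmat ** Delta U V ** dagger Vmat =
    cscale (1 / 2) (block_mat (mat 1) (mat 1) (mat (- \<i>)) (mat \<i>) ** Delta U V **
      block_mat (mat 1) (mat \<i>) (mat 1) (mat (- \<i>)))"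
    unfolding dagger_Vmat unfolding Vmat_def cscale_mult_left cscale_mult_right cscale_cscale
      sqrt_half_square ..
  show ?thesis
    unfolding quadrature_def * unfolding Delta_def block_mat_mult
    by (simp add: vec_eq_iff mat_mult_left mat_mult_right cscale_def block_mat_def conj_mat_def
        split: sum.split)
qed

lemma cplx_mat_mult: "cplx_mat (X ** Y) = cplx_mat X ** cplx_mat Y"
  by (simp add: vec_eq_iff matrix_matrix_mult_def)

lemma cplx_mat_0: "cplx_mat 0 = 0"
  by (simp add: vec_eq_iff)

lemma cplx_mat_eq_iff: "cplx_mat X = cplx_mat Y \<longleftrightarrow> X = Y"
  by (simp add: vec_eq_iff)

text \<open>Inserting \<open>dagger Vmat ** Vmat = mat 1\<close> between the factors splits the
  product. Doubled-up factors have real conjugates, so taking real parts loses nothing and respects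
  the product.\<close>

lemma quadrature_mult:
  assumes "doubled_up X" "doubled_up Y"
  shows "quadrature (X ** Y) = quadrature X ** quadrature Y"
proof -
  have "cplx_mat (quadrature (X ** Y)) = Vmat ** (X ** Y) ** dagger Vmat"
    unfolding quadrature_def using assms by (intro of_real_Re_quadrature doubled_up_mult)
  also have "\<dots> = (Vmat ** X ** dagger Vmat) ** (Vmat ** Y ** dagger Vmat)"
  proof -
    have "(Vmat ** X ** dagger Vmat) ** (Vmat ** Y ** dagger Vmat) =
        Vmat ** X ** (dagger Vmat ** Vmat) ** Y ** dagger Vmat"
      by (simp only: matrix_mul_assoc)
    then show ?thesis
      by (simp add: dagger_Vmat_Vmat matrix_mul_assoc)
  qed
  also have "\<dots> = cplx_mat (quadrature X ** quadrature Y)"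
    unfolding quadrature_def cplx_mat_mult using assms by (simp only: of_real_Re_quadrature)
  finally show ?thesis
    by (simp only: cplx_mat_eq_iff)
qed

lemma quadrature_diff: "quadrature (X - Y) = quadrature X - quadrature Y"
proof -
  have "Vmat ** (X - Y) ** dagger Vmat = Vmat ** X ** dagger Vmat - Vmat ** Y ** dagger Vmat"
    by (simp add: vec_eq_iff matrix_matrix_mult_def algebra_simps sum_subtractf)
  then show ?thesis
    by (simp add: quadrature_def vec_eq_iff)
qed

lemma quadrature_cscale: "quadrature (cscale (1 / 2) X) = (1 / 2) *\<^sub>R quadrature X"
  by (simp add: quadrature_def cscale_mult_left cscale_mult_right) (simp add: vec_eq_iff cscale_def)

text \<open>Multiplying by \<open>Jmat\<close> on both sides flips the sign of the off-diagonal
  blocks of the adjoint. The result has the \<open>Delta\<close> shape needed for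
  \<open>quadrature_Delta\<close>.\<close>

lemma flat_Delta: "flat (Delta U V) = Delta (dagger U) (- transpose V)"
proof -
  have "dagger (Delta U V) = block_mat (dagger U) (transpose V) (dagger V) (transpose U)"
    by (simp add: vec_eq_iff Delta_def dagger_def conj_mat_def transpose_def block_mat_def
        split: sum.split)
  then show ?thesis
    by (simp add: uminus_mat_1 flat_def Jmat_def Delta_def block_mat_mult mat_mult_left mat_mult_right)
      (simp add: vec_eq_iff dagger_def conj_mat_def transpose_def block_mat_def cscale_def
        split: sum.split)
qed

lemma iJ_Delta: "cscale (- \<i>) (Jmat ** Delta U V) = Delta (cscale (- \<i>) U) (cscale (- \<i>) V)"
  by (simp add: uminus_mat_1 Jmat_def Delta_def block_mat_mult mat_mult_left)
    (simp add: vec_eq_iff conj_mat_def block_mat_def cscale_def split: sum.split)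

section \<open>Real block forms of the system matrices\<close>

lemma sys_D_block: "sys_D S = block_mat (Re_mat S) (- Im_mat S) (Im_mat S) (Re_mat S)"
proof -
  have "sys_D S = quadrature (Delta S 0)"
    by (simp add: sys_D_def cplx_D_def quadrature_def)
  then show ?thesis
    by (simp add: quadrature_Delta vec_eq_iff block_mat_def split: sum.split)
qed

lemma sys_C_block:
  "sys_C Cm Cp =
     block_mat (Re_mat (Cm + Cp)) (- Im_mat (Cm - Cp)) (Im_mat (Cm + Cp)) (Re_mat (Cm - Cp))"
proof -
  have "sys_C Cm Cp = quadrature (Delta Cm Cp)"
    by (simp add: sys_C_def cplx_C_def quadrature_def)
  then show ?thesis
    by (simp add: quadrature_Delta vec_eq_iff block_mat_def split: sum.split)
qed

text \<open>This is the symplectic adjoint of \<open>sys_C Cm Cp\<close>, the real counterpart of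
  \<open>flat\<close>; both \<open>sys_B\<close> and the damping term of \<open>sys_A\<close> factor
  through it.\<close>

definition input_coupling :: "complex^'n^'m \<Rightarrow> complex^'n^'m \<Rightarrow> real^('m + 'm)^('n + 'n)" where
  "input_coupling Cm Cp =
     block_mat (transpose (Re_mat (Cm - Cp))) (transpose (Im_mat (Cm - Cp)))
       (- transpose (Im_mat (Cm + Cp))) (transpose (Re_mat (Cm + Cp)))"

lemma quadrature_flat_Delta: "quadrature (flat (Delta Cm Cp)) = input_coupling Cm Cp"
  unfolding flat_Delta quadrature_Delta
  by (simp add: input_coupling_def vec_eq_iff block_mat_def dagger_def conj_mat_def transpose_def
      split: sum.split)

lemma sys_B_eq: "sys_B S Cm Cp = - (input_coupling Cm Cp ** sys_D S)"
proof -
  have "sys_B S Cm Cp = - quadrature (flat (Delta Cm Cp) ** Delta S 0)"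
    by (simp add: sys_B_def cplx_B_def quadrature_def vec_eq_iff matrix_mul_assoc)
  also have "\<dots> = - (quadrature (flat (Delta Cm Cp)) ** quadrature (Delta S 0))"
    by (simp add: quadrature_mult doubled_up_flat doubled_up_Delta)
  finally show ?thesis
    by (simp add: quadrature_flat_Delta) (simp add: sys_D_def cplx_D_def quadrature_def)
qed

text \<open>The factor \<open>- \<i>\<close> in the Hamiltonian term exchanges real and imaginary
  parts, so a purely imaginary \<open>Delta Om Op\<close> makes that term block diagonal.\<close>

lemma sys_A_eq:
  "sys_A Cm Cp Om Op =
     block_mat (Im_mat (Om + Op)) (Re_mat (Om - Op)) (- Re_mat (Om + Op)) (Im_mat (Om - Op))
     - (1 / 2) *\<^sub>R (input_coupling Cm Cp ** sys_C Cm Cp)"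
proof -
  have "sys_A Cm Cp Om Op = quadrature (cscale (- \<i>) (Jmat ** Delta Om Op))
      - (1 / 2) *\<^sub>R quadrature (flat (Delta Cm Cp) ** Delta Cm Cp)"
    unfolding quadrature_cscale[symmetric] quadrature_diff[symmetric]
    by (simp add: sys_A_def cplx_A_def quadrature_def)
  also have "quadrature (flat (Delta Cm Cp) ** Delta Cm Cp) = input_coupling Cm Cp ** sys_C Cm Cp"
    by (simp add: quadrature_mult doubled_up_flat doubled_up_Delta quadrature_flat_Delta)
      (simp add: sys_C_def cplx_C_def quadrature_def)
  also have "quadrature (cscale (- \<i>) (Jmat ** Delta Om Op)) =
      block_mat (Im_mat (Om + Op)) (Re_mat (Om - Op)) (- Re_mat (Om + Op)) (Im_mat (Om - Op))"
    unfolding iJ_Delta quadrature_Delta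
    by (simp add: vec_eq_iff block_mat_def cscale_def split: sum.split)
  finally show ?thesis .
qed


section \<open>Back-action evasion\<close>

lemma block_mat_eq_iff:
  "block_mat P Q R T = block_mat P' Q' R' T' \<longleftrightarrow> P = P' \<and> Q = Q' \<and> R = R' \<and> T = T'"
  by (auto simp: vec_eq_iff block_mat_def split_sum_all split: sum.split)

lemma map_matrix_block_mat:
  "map_matrix f (block_mat P Q R T) =
     block_mat (map_matrix f P) (map_matrix f Q) (map_matrix f R) (map_matrix f T)"
  by (simp add: vec_eq_iff block_mat_def split: sum.split)

lemma block_mat_exhaust:
  obtains P Q R T where "M = block_mat P Q R T"
proof
  show "M = block_mat (\<chi> i j. M $ Inl i $ Inl j) (\<chi> i j. M $ Inl i $ Inr j)
      (\<chi> i j. M $ Inr i $ Inl j) (\<chi> i j. M $ Inr i $ Inr j)"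
    by (simp add: vec_eq_iff block_mat_def split: sum.split)
qed

text \<open>The identity for the right inverse gives \<open>P ** Q' = 0\<close> and
  \<open>T ** R' = 0\<close>; the one for the left inverse lets \<open>P\<close> and
  \<open>T\<close> be cancelled.\<close>

lemma matrix_inv_block_diag:
  fixes P :: "'a::field^'k^'k" and T :: "'a^'l^'l"
  assumes "invertible (block_mat P 0 0 T)"
  obtains P' T' where "matrix_inv (block_mat P 0 0 T) = block_mat P' 0 0 T'"
proof -
  let ?M = "block_mat P 0 0 T"
  obtain P' Q' R' T' where N: "matrix_inv ?M = block_mat P' Q' R' T'"
    by (rule block_mat_exhaust)
  have "?M ** matrix_inv ?M = mat 1 \<and> matrix_inv ?M ** ?M = mat 1"
    using assms unfolding invertible_def matrix_inv_def by (rule someI_ex)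
  then have eqs: "P ** Q' = 0" "T ** R' = 0" "P' ** P = mat 1" "T' ** T = mat 1"
    by (simp_all add: N block_mat_mult mat_1_block block_mat_eq_iff)
  have "Q' = 0"
    by (metis eqs(1,3) matrix_mul_assoc matrix_mul_lid times0_right)
  moreover have "R' = 0"
    by (metis eqs(2,4) matrix_mul_assoc matrix_mul_lid times0_right)
  ultimately show thesis
    using N that by simp
qed

text \<open>The resolvent of \<open>A\<close> is block diagonal, and two antidiagonal factors around
  it give a block diagonal product just as two diagonal ones do.\<close>

lemma transfer_matrix_block_diag:
  fixes A1 :: "real^'k^'k" and A2 :: "real^'l^'l"
    and B :: "real^('p::finite + 'q::finite)^('k + 'l)"
    and C :: "real^('k + 'l)^('r::finite + 's::finite)"
  assumes A: "A = block_mat A1 0 0 A2" and D: "D = block_mat D1 0 0 D2"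
    and BC: "B = block_mat B1 0 0 B2 \<and> C = block_mat C1 0 0 C2 \<or>
             B = block_mat 0 B3 B4 0 \<and> C = block_mat 0 C3 C4 0"
    and inv: "invertible (mat s - cplx_mat A)"
  shows "upper_right_block (transfer_matrix A B C D s) = 0"
    and "lower_left_block (transfer_matrix A B C D s) = 0"
proof -
  have *: "mat s - cplx_mat A = block_mat (mat s - cplx_mat A1) 0 0 (mat s - cplx_mat A2)"
    by (simp add: A vec_eq_iff block_mat_def mat_def split: sum.split)
  obtain P T where N: "matrix_inv (mat s - cplx_mat A) = block_mat P 0 0 T"
    using inv unfolding * by (rule matrix_inv_block_diag)
  obtain P' T' where
    "cplx_mat C ** matrix_inv (mat s - cplx_mat A) ** cplx_mat B = block_mat P' 0 0 T'"
    unfolding N using BC by (auto simp: map_matrix_block_mat block_mat_mult cplx_mat_0)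
  then show "upper_right_block (transfer_matrix A B C D s) = 0"
    and "lower_left_block (transfer_matrix A B C D s) = 0"
    unfolding transfer_matrix_def D
    by (simp_all add: vec_eq_iff upper_right_block_def lower_left_block_def block_mat_def)
qed


section \<open>Observability\<close>

lemma observable_iff_span: "observable A C \<longleftrightarrow> vec.span (observability_rows A C) = UNIV"
  unfolding observable_def by (metis vec.dim_eq_full vec.span_UNIV vec_dim_card)

lemma rows_eq_range: "rows M = range (\<lambda>i. row i M)"
  by (auto simp: rows_def)

lemma row_mult: "row i (M ** N) = row i M v* N"
  by (simp add: vec_eq_iff row_def matrix_matrix_mult_def vector_matrix_mult_def)

lemma rows_mult: "rows (M ** N) = (\<lambda>v. v v* N) ` rows M"
  by (simp add: rows_eq_range row_mult image_image)

lemma observability_rows_rowI: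
  "j < CARD('x) \<Longrightarrow> row i (C ** mat_pow (A :: 'a::field^'x^'x) j) \<in> observability_rows A C"
  by (auto simp: observability_rows_def rows_eq_range)

lemma mat_pow_uminus:
  "mat_pow (- A) j = (if even j then mat_pow A j else - mat_pow (A :: 'a::ring_1^'k^'k) j)"
proof (induction j)
  case (Suc j)
  have "X ** (- A) = - (X ** A)" "(- X) ** (- A) = X ** A" for X :: "'a^'k^'k"
    by (simp_all add: vec_eq_iff matrix_matrix_mult_def sum_negf)
  with Suc show ?case by simp
qed simp

text \<open>Powers of \<open>- A\<close> and \<open>A\<close> differ only by a sign, which spans do
  not see. This absorbs the sign in \<open>\<i> * X = - Im X\<close> for purely imaginary
  \<open>X\<close>.\<close>

lemma observable_uminus:
  fixes A :: "'a::field^'x^'x"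
  assumes "observable (- A) C"
  shows "observable A C"
proof -
  have "observability_rows (- A) C \<subseteq> vec.span (observability_rows A C)"
  proof
    fix v assume "v \<in> observability_rows (- A) C"
    then obtain i j where j: "j < CARD('x)" and v: "v = row i (C ** mat_pow (- A) j)"
      by (auto simp: observability_rows_def rows_eq_range)
    let ?w = "row i (C ** mat_pow A j)"
    have "row i (C ** - mat_pow A j) = - ?w"
      by (simp add: vec_eq_iff row_def matrix_matrix_mult_def sum_negf)
    then have "v = ?w \<or> v = - ?w"
      by (simp add: v mat_pow_uminus)
    moreover have "?w \<in> vec.span (observability_rows A C)"
      using j by (intro vec.span_base observability_rows_rowI)
    ultimately show "v \<in> vec.span (observability_rows A C)"
      by (auto intro: vec.span_neg)
  qed
  then have "vec.span (observability_rows (- A) C) \<subseteq> vec.span (observability_rows A C)"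
    by (intro vec.span_minimal vec.subspace_span)
  with assms show ?thesis
    by (auto simp: observable_iff_span)
qed

text \<open>A complex scalar mixes real and imaginary parts with real coefficients, so the induction
  has to carry both parts together.\<close>

lemma Re_Im_span:
  fixes R :: "(complex^'n) set" and W :: "(real^'n) set"
  assumes "\<And>r. r \<in> R \<Longrightarrow> (\<chi> k. Re (r $ k)) \<in> span W \<and> (\<chi> k. Im (r $ k)) \<in> span W"
    and "v \<in> vec.span R"
  shows "(\<chi> k. Re (v $ k)) \<in> span W \<and> (\<chi> k. Im (v $ k)) \<in> span W"
  using assms(2)
proof (induction rule: vec.span_induct_alt)
  case base
  have "(\<chi> k. 0) = (0 :: real^'n)" by (simp add: vec_eq_iff)
  then show ?case by (simp add: span_zero)
next
  case (step c r v)
  let ?re = "\<lambda>v :: complex^'n. \<chi> k. Re (v $ k)" and ?im = "\<lambda>v :: complex^'n. \<chi> k. Im (v $ k)"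
  have "?re (c *s r + v) = Re c *\<^sub>R ?re r - Im c *\<^sub>R ?im r + ?re v"
    "?im (c *s r + v) = Re c *\<^sub>R ?im r + Im c *\<^sub>R ?re r + ?im v"
    by (simp_all add: vec_eq_iff)
  with step assms(1)[OF step(1)] show ?case
    by (simp add: span_add span_diff span_scale)
qed

lemma cplx_mat_pow: "mat_pow (cplx_mat A) j = cplx_mat (mat_pow A j)"
proof (induction j)
  case 0
  show ?case by (simp add: vec_eq_iff mat_def)
qed (simp add: cplx_mat_mult)

lemma linear_vector_matrix_mult: "linear (\<lambda>v :: real^'k. v v* M)"
  by (intro linearI) (simp_all add: vector_matrix_left_distrib scaleR_vector_matrix_assoc)

text \<open>As \<open>F\<close> is real, its powers act separately on the real and imaginary parts
  of the rows of \<open>C\<close>, and both parts start in the row space of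
  \<open>K\<close>.\<close>

lemma observable_cplx_mat:
  fixes F :: "real^'n^'n" and C :: "complex^'n^'m" and K :: "real^'n^'p"
  assumes obs: "observable (cplx_mat F) C"
    and rows: "\<And>i. row i (Re_mat C) \<in> span (rows K)" "\<And>i. row i (Im_mat C) \<in> span (rows K)"
  shows "observable F K"
proof -
  have image: "v v* mat_pow F j \<in> span (observability_rows F K)"
    if "v \<in> span (rows K)" "j < CARD('n)" for v j
  proof -
    have "v v* mat_pow F j \<in> span (rows (K ** mat_pow F j))"
      unfolding rows_mult linear_span_image[OF linear_vector_matrix_mult] using that(1) by simp
    moreover have "rows (K ** mat_pow F j) \<subseteq> observability_rows F K"
      using that(2) by (auto simp: observability_rows_def)
    ultimately show ?thesis
      using span_mono by blast
  qed
  have "(\<chi> k. Re (r $ k)) \<in> span (observability_rows F K) \<and>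
      (\<chi> k. Im (r $ k)) \<in> span (observability_rows F K)"
    if "r \<in> observability_rows (cplx_mat F) C" for r
  proof -
    from that obtain i j where j: "j < CARD('n)" and r: "r = row i (C ** cplx_mat (mat_pow F j))"
      by (auto simp: observability_rows_def rows_eq_range cplx_mat_pow)
    have "(\<chi> k. Re (r $ k)) = row i (Re_mat C) v* mat_pow F j"
      "(\<chi> k. Im (r $ k)) = row i (Im_mat C) v* mat_pow F j"
      by (simp_all add: vec_eq_iff r row_def matrix_matrix_mult_def vector_matrix_mult_def)
    with image[OF rows(1) j] image[OF rows(2) j] show ?thesis by simp
  qed
  from Re_Im_span[of "observability_rows (cplx_mat F) C", OF this]
  have "(\<chi> k. Re (v $ k)) \<in> span (observability_rows F K)" for v
    using obs by (simp add: observable_iff_span)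
  \<comment> \<open>A real vector is the real part of its own complexification, so the real span is
    everything.\<close>
  from this[of "\<chi> k. complex_of_real (w $ k)" for w]
  have "w \<in> span (observability_rows F K)" for w
    by simp
  then show ?thesis
    by (auto simp: observable_iff_span span_vec_eq)
qed


section \<open>Quantum nondemolition variables\<close>

text \<open>The intertwining \<open>T ** A = F ** T\<close> extends to all powers, so the rows for
  \<open>(A, C)\<close> include the images under \<open>T\<close> of those for
  \<open>(F, K)\<close>.\<close>

lemma QND_variableI:
  fixes A :: "real^'x^'x" and B :: "real^'u^'x" and C :: "real^'x^'y" and T :: "real^'x^'z"
  assumes TA: "T ** A = F ** T" and TB: "T ** B = 0" and C: "C = K ** T"
    and obs: "observable F K" and card: "CARD('z) \<le> CARD('x)"
  shows "QND_variable A B C T"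
proof -
  have "T ** mat_pow A j = mat_pow F j ** T" for j
    by (induction j) (simp_all add: matrix_mul_assoc, simp flip: matrix_mul_assoc add: TA)
  then have "C ** mat_pow A j = K ** mat_pow F j ** T" for j
    by (simp add: C flip: matrix_mul_assoc)
  \<comment> \<open>The bound \<open>card\<close> places the powers of \<open>F\<close> below
    \<open>CARD('z)\<close> within the range of powers allowed for \<open>A\<close>.\<close>
  then have sub: "(\<lambda>v. v v* T) ` observability_rows F K \<subseteq> observability_rows A C"
    using card by (fastforce simp: observability_rows_def rows_mult[of _ T])
  \<comment> \<open>The rows of \<open>T\<close> are the images of the unit vectors, which lie in
    the full span for \<open>(F, K)\<close>.\<close>
  have "rows T = (\<lambda>v. v v* T) ` rows (mat 1)"
    by (metis matrix_mul_lid rows_mult)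
  also have "\<dots> \<subseteq> (\<lambda>v. v v* T) ` span (observability_rows F K)"
    using obs by (auto simp: observable_iff_span span_vec_eq)
  also have "\<dots> = span ((\<lambda>v. v v* T) ` observability_rows F K)"
    by (simp add: linear_span_image linear_vector_matrix_mult)
  also have "\<dots> \<subseteq> span (observability_rows A C)"
    by (rule span_mono) (rule sub)
  finally show ?thesis
    unfolding QND_variable_def using TA TB by blast
qed

section \<open>Selecting the position or the momentum half\<close>

lemma sum_UNIV_Plus:
  "(\<Sum>x\<in>UNIV. g x) = (\<Sum>x\<in>UNIV. g (Inl x)) + (\<Sum>x\<in>UNIV. g (Inr x))"
  for g :: "'x::finite + 'y::finite \<Rightarrow> 'a::comm_monoid_add"
  by (subst UNIV_Plus_UNIV[symmetric], subst sum.Plus) simp_all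

lemma q_selector_mult: "(q_selector ** M) $ i $ j = M $ Inl i $ j"
  by (simp add: q_selector_def matrix_matrix_mult_def sum_UNIV_Plus mat_def
      if_distrib [where f = "\<lambda>x. x * _"] cong: if_cong)

lemma p_selector_mult: "(p_selector ** M) $ i $ j = M $ Inr i $ j"
  by (simp add: p_selector_def matrix_matrix_mult_def sum_UNIV_Plus mat_def
      if_distrib [where f = "\<lambda>x. x * _"] cong: if_cong)

lemma mult_q_selector: "(M ** q_selector) $ i $ j = (case j of Inl k \<Rightarrow> M $ i $ k | Inr k \<Rightarrow> 0)"
  by (simp add: q_selector_def matrix_matrix_mult_def mat_def if_distrib
      cong: if_cong split: sum.split)

lemma mult_p_selector: "(M ** p_selector) $ i $ j = (case j of Inl k \<Rightarrow> 0 | Inr k \<Rightarrow> M $ i $ k)"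
  by (simp add: p_selector_def matrix_matrix_mult_def mat_def if_distrib
      cong: if_cong split: sum.split)

text \<open>The zero blocks say that \<open>q\<close> is driven neither by \<open>p\<close> nor by
  the inputs, and that the output sees \<open>q\<close> alone, through \<open>K1\<close> stacked on
  \<open>K2\<close>.\<close>

lemma QND_variable_q_selector:
  fixes K1 :: "real^'n^'m" and K2 :: "real^'n^'l"
  assumes "observable F (\<chi> i. case i of Inl a \<Rightarrow> K1 $ a | Inr a \<Rightarrow> K2 $ a)"
  shows "QND_variable (block_mat F 0 R A2) (block_mat 0 0 B1 B2) (block_mat K1 0 K2 0) q_selector"
proof (rule QND_variableI[OF _ _ _ assms])
  show "q_selector ** block_mat F 0 R A2 = F ** q_selector"
    by (simp add: vec_eq_iff q_selector_mult mult_q_selector block_mat_def split: sum.split)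
qed (simp_all add: vec_eq_iff q_selector_mult mult_q_selector block_mat_def split: sum.split)

lemma QND_variable_p_selector:
  fixes K1 :: "real^'n^'m" and K2 :: "real^'n^'l"
  assumes "observable F (\<chi> i. case i of Inl a \<Rightarrow> K1 $ a | Inr a \<Rightarrow> K2 $ a)"
  shows "QND_variable (block_mat A1 Q 0 F) (block_mat B1 B2 0 0) (block_mat 0 K1 0 K2) p_selector"
proof (rule QND_variableI[OF _ _ _ assms])
  show "p_selector ** block_mat A1 Q 0 F = F ** p_selector"
    by (simp add: vec_eq_iff p_selector_mult mult_p_selector block_mat_def split: sum.split)
qed (simp_all add: vec_eq_iff p_selector_mult mult_p_selector block_mat_def split: sum.split)

text \<open>Only row spaces matter, so the real coefficients allow the output blocks to differ from
  the parts of \<open>C\<close> by order, sign and scale.\<close>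

lemma observable_stacked:
  fixes F :: "real^'n^'n" and C :: "complex^'n^'m" and K1 K2 :: "real^'n^'m"
  assumes "observable (- cplx_mat F) C"
    and "Re_mat C = a *\<^sub>R K1 + b *\<^sub>R K2" "Im_mat C = c *\<^sub>R K1 + d *\<^sub>R K2"
  shows "observable F (\<chi> i. case i of Inl a \<Rightarrow> K1 $ a | Inr a \<Rightarrow> K2 $ a)" (is "observable F ?K")
proof (rule observable_cplx_mat)
  show "observable (cplx_mat F) C"
    using assms(1) by (rule observable_uminus)
  have "row (Inl i) ?K = row i K1" "row (Inr i) ?K = row i K2" for i
    by (simp_all add: row_def)
  then have "row i K1 \<in> rows ?K" "row i K2 \<in> rows ?K" for i
    unfolding rows_eq_range by (metis rangeI)+
  then have comb: "x *\<^sub>R row i K1 + y *\<^sub>R row i K2 \<in> span (rows ?K)" for x y i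
    by (intro span_add span_scale span_base)
  have "row i (x *\<^sub>R K1 + y *\<^sub>R K2) = x *\<^sub>R row i K1 + y *\<^sub>R row i K2" for x y i
    by (simp add: vec_eq_iff row_def)
  then show "row i (Re_mat C) \<in> span (rows ?K)" "row i (Im_mat C) \<in> span (rows ?K)" for i
    unfolding assms(2,3) using comb by simp_all
qed

theorem theorem1:
  fixes S :: "complex^'m^'m"
    and Cm Cp :: "complex^'n^'m"
    and Om Op :: "complex^'n^'n"
  assumes "unitary S"
    and "hermitian (Delta Om Op)"
    and "real_mat S"
    and "purely_imaginary_mat (Delta Om Op)"
    and "real_mat (Delta Cm Cp) \<or> purely_imaginary_mat (Delta Cm Cp)"
  shows "let A = sys_A Cm Cp Om Op; B = sys_B S Cm Cp; C = sys_C Cm Cp; D = sys_D S in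
    BAE_q_out_wrt_p_in A B C D \<and> BAE_p_out_wrt_q_in A B C D \<and>
    (Cm = Cp \<longrightarrow> observable (cscale \<i> (Om + Op)) Cm \<longrightarrow> QND_variable A B C q_selector) \<and>
    (Cm = - Cp \<longrightarrow> observable (cscale \<i> (Om - Op)) Cm \<longrightarrow> QND_variable A B C p_selector)"
proof -
  let ?A = "sys_A Cm Cp Om Op" and ?B = "sys_B S Cm Cp" and ?C = "sys_C Cm Cp" and ?D = "sys_D S"
  let ?G = "input_coupling Cm Cp"
  have "Re (Om $ i $ j) = 0 \<and> Re (Op $ i $ j) = 0" for i j
    using assms(4) unfolding purely_imaginary_mat_def
    by (auto dest: spec2[of _ "Inl i" "Inl j"] spec2[of _ "Inl i" "Inr j"]
        simp: Delta_def block_mat_def)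
  then have Om: "Re_mat (Om + Op) = 0" "Re_mat (Om - Op) = 0"
    by (simp_all add: vec_eq_iff)
  have transpose_0: "transpose (0 :: real^'x^'y) = 0"
    by (simp_all add: vec_eq_iff transpose_def)
  have D: "?D = block_mat (Re_mat S) 0 0 (Re_mat S)"
    using assms(3) by (simp add: sys_D_block vec_eq_iff block_mat_def real_mat_def split: sum.split)
  \<comment> \<open>Real coupling kills the \<open>Im_mat\<close> blocks and imaginary coupling the
    \<open>Re_mat\<close> blocks, in \<open>?G\<close> and \<open>?C\<close> simultaneously.\<close>
  have coupling: "(\<exists>G1 G2 C1 C2. ?G = block_mat G1 0 0 G2 \<and> ?C = block_mat C1 0 0 C2) \<or>
      (\<exists>G1 G2 C1 C2. ?G = block_mat 0 G1 G2 0 \<and> ?C = block_mat 0 C1 C2 0)"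
    using assms(5)
  proof
    assume "real_mat (Delta Cm Cp)"
    then have "Im (Cm $ i $ j) = 0 \<and> Im (Cp $ i $ j) = 0" for i j
      unfolding real_mat_def
      by (auto dest: spec2[of _ "Inl i" "Inl j"] spec2[of _ "Inl i" "Inr j"]
          simp: Delta_def block_mat_def)
    then have "Im_mat (Cm + Cp) = 0" "Im_mat (Cm - Cp) = 0"
      by (simp_all add: vec_eq_iff)
    then show ?thesis
      unfolding input_coupling_def sys_C_block by (simp add: transpose_0) blast
  next
    assume "purely_imaginary_mat (Delta Cm Cp)"
    then have "Re (Cm $ i $ j) = 0 \<and> Re (Cp $ i $ j) = 0" for i j
      unfolding purely_imaginary_mat_def
      by (auto dest: spec2[of _ "Inl i" "Inl j"] spec2[of _ "Inl i" "Inr j"]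
          simp: Delta_def block_mat_def)
    then have "Re_mat (Cm + Cp) = 0" "Re_mat (Cm - Cp) = 0"
      by (simp_all add: vec_eq_iff)
    then show ?thesis
      unfolding input_coupling_def sys_C_block by (simp add: transpose_0) blast
  qed
  have uminus_block: "- block_mat P Q R T = block_mat (- P) (- Q) (- R) (- T)"
    for P Q R T :: "real^'x^'y"
    by (simp add: vec_eq_iff block_mat_def split: sum.split)
  have A_block: "block_mat P 0 0 T - (1 / 2) *\<^sub>R block_mat P' 0 0 T' =
      block_mat (P - (1 / 2) *\<^sub>R P') 0 0 (T - (1 / 2) *\<^sub>R T')" for P P' T T' :: "real^'n^'n"
    by (simp add: vec_eq_iff block_mat_def split: sum.split)
  have GC: "\<exists>P T. ?G ** ?C = block_mat P 0 0 T"
    using coupling by (auto simp: block_mat_mult block_mat_eq_iff)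
  have A0: "?A = block_mat (Im_mat (Om + Op)) 0 0 (Im_mat (Om - Op)) - (1 / 2) *\<^sub>R (?G ** ?C)"
    by (simp add: sys_A_eq Om)
  obtain A1 A2 where A: "?A = block_mat A1 0 0 A2"
    using GC by (auto simp: A0 A_block)
  have B: "?B = - (?G ** block_mat (Re_mat S) 0 0 (Re_mat S))"
    by (simp add: sys_B_eq D)
  obtain B1 B2 B3 B4 C1 C2 C3 C4 where
    BC: "?B = block_mat B1 0 0 B2 \<and> ?C = block_mat C1 0 0 C2 \<or>
         ?B = block_mat 0 B3 B4 0 \<and> ?C = block_mat 0 C3 C4 0"
    using coupling unfolding B
    by (elim disjE exE conjE; simp add: block_mat_mult uminus_block; metis)
  have BAE: "BAE_q_out_wrt_p_in ?A ?B ?C ?D" "BAE_p_out_wrt_q_in ?A ?B ?C ?D"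
    unfolding BAE_q_out_wrt_p_in_def BAE_p_out_wrt_q_in_def
    using transfer_matrix_block_diag[OF A D BC] by blast+
  have q: "QND_variable ?A ?B ?C q_selector"
    if eq: "Cm = Cp" and obs: "observable (cscale \<i> (Om + Op)) Cm"
  proof -
    have zero: "Re_mat (Cm - Cp) = 0" "Im_mat (Cm - Cp) = 0"
      using eq by (simp_all add: vec_eq_iff)
    obtain G3 G4 where G: "?G = block_mat 0 0 G3 G4"
      unfolding input_coupling_def zero transpose_0 by simp
    have C: "?C = block_mat (Re_mat (Cm + Cp)) 0 (Im_mat (Cm + Cp)) 0"
      unfolding sys_C_block zero by simp
    obtain P T where PT: "?G ** ?C = block_mat P 0 0 T"
      using GC by blast
    \<comment> \<open>The vanishing upper half of \<open>?G\<close> removes all damping from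
      \<open>q\<close>, which leaves \<open>Im_mat (Om + Op)\<close> as its generator.\<close>
    then have "P = 0"
      by (simp add: G C block_mat_mult block_mat_eq_iff)
    then have A: "?A = block_mat (Im_mat (Om + Op)) 0 0 (Im_mat (Om - Op) - (1 / 2) *\<^sub>R T)"
      by (simp add: A0 PT A_block)
    have "cscale \<i> (Om + Op) = - cplx_mat (Im_mat (Om + Op))"
      using Om(1) by (simp add: vec_eq_iff cscale_def complex_eq_iff)
    with obs have "observable (- cplx_mat (Im_mat (Om + Op))) Cm"
      by simp
    then have "observable (Im_mat (Om + Op))
        (\<chi> i. case i of Inl a \<Rightarrow> Re_mat (Cm + Cp) $ a | Inr a \<Rightarrow> Im_mat (Cm + Cp) $ a)"
      \<comment> \<open>Here \<open>Cm + Cp = 2 Cm\<close>, whence the halves.\<close>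
      by (rule observable_stacked[where a = "1 / 2" and b = 0 and c = 0 and d = "1 / 2"])
        (simp_all add: vec_eq_iff eq)
    then show ?thesis
      unfolding A B G C block_mat_mult uminus_block by simp (rule QND_variable_q_selector)
  qed
  have p: "QND_variable ?A ?B ?C p_selector"
    if eq: "Cm = - Cp" and obs: "observable (cscale \<i> (Om - Op)) Cm"
  proof -
    have zero: "Re_mat (Cm + Cp) = 0" "Im_mat (Cm + Cp) = 0"
      using eq by (simp_all add: vec_eq_iff)
    obtain G1 G2 where G: "?G = block_mat G1 G2 0 0"
      unfolding input_coupling_def zero transpose_0 by simp
    have C: "?C = block_mat 0 (- Im_mat (Cm - Cp)) 0 (Re_mat (Cm - Cp))"
      unfolding sys_C_block zero by simp
    obtain P T where PT: "?G ** ?C = block_mat P 0 0 T"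
      using GC by blast
    \<comment> \<open>Now the lower half of \<open>?G\<close> vanishes, and \<open>p\<close> is the
      undamped component.\<close>
    then have "T = 0"
      by (simp add: G C block_mat_mult block_mat_eq_iff)
    then have A: "?A = block_mat (Im_mat (Om + Op) - (1 / 2) *\<^sub>R P) 0 0 (Im_mat (Om - Op))"
      by (simp add: A0 PT A_block)
    have "cscale \<i> (Om - Op) = - cplx_mat (Im_mat (Om - Op))"
      using Om(2) by (simp add: vec_eq_iff cscale_def complex_eq_iff)
    with obs have "observable (- cplx_mat (Im_mat (Om - Op))) Cm"
      by simp
    then have "observable (Im_mat (Om - Op))
        (\<chi> i. case i of Inl a \<Rightarrow> (- Im_mat (Cm - Cp)) $ a | Inr a \<Rightarrow> Re_mat (Cm - Cp) $ a)"
      \<comment> \<open>The upper output block is \<open>- Im_mat (Cm - Cp)\<close>, that is, minus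
        twice the imaginary part of \<open>Cm\<close>, so \<open>c\<close> is negative and the roles
        of the two blocks are exchanged.\<close>
      by (rule observable_stacked[where a = 0 and b = "1 / 2" and c = "- 1 / 2" and d = 0])
        (simp_all add: vec_eq_iff eq)
    then show ?thesis
      unfolding A B G C block_mat_mult uminus_block by simp (rule QND_variable_p_selector)
  qed
  show ?thesis
    unfolding Let_def using BAE q p by blast
qed

end
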